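(* Let $q$ be a power of $2$ and let $m$ be odd. Let $n=q^m-1$ and let $\beta$ be a primitive $n$-th root of unity in $\mathbb{F}_{q^m}$. Put $\delta=q^{\frac{m+1}{2}}-q+1$ and assume $\delta\ge 2$. Let $g(x)$ be the generator polynomial of the BCH code $\mathcal{C}_{(q,n,\delta,1,\beta)}$, let $h(x)=(x^n-1)/g(x)$, and let $g^\perp(x)=x^{\deg h(x)}h(x^{-1})/h(0)$ be the generator polynomial of $\mathcal{C}_{(q,n,\delta,1,\beta)}^\perp$. Let $\mathcal{C}'$ denote the cyclic code of length $2n$ over $\mathbb{F}_q$ with generator polynomial $g(x)g^\perp(x)$. Then $\mathcal{C}'$ is a Euclidean self-dual cyclic code with parameters $[2(q^m-1),\,q^m-1,\,d]_q$, where $$d\ge q^{\frac{m+1}{2}}-q+2.$$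
   Context: An $[n,k,d]_q$ code is a $k$-dimensional linear subspace of $\mathbb{F}_q^n$ with minimum Hamming distance $d$. The Euclidean dual is $\mathcal{C}^\perp=\{c\in\mathbb{F}_q^n:\sum_i c_iy_i=0\ \forall y\in\mathcal{C}\}$; $\mathcal{C}$ is Euclidean self-dual if $\mathcal{C}=\mathcal{C}^\perp$. A cyclic code of length $N$ over $\mathbb{F}_q$ is identified with an ideal of $\mathbb{F}_q[x]/\langle x^N-1\rangle$ via $(c_0,\dots,c_{N-1})\mapsto c_0+c_1x+\dots+c_{N-1}x^{N-1}$; its generator polynomial is the unique monic divisor of $x^N-1$ generating it. For $\gcd(n,q)=1$ and $\beta$ a primitive $n$-th root of unity, $m_{\beta^i}(x)$ denotes the minimal polynomial of $\beta^i$ over $\mathbb{F}_q$. For integers $\delta\ge2$ and $b$, the BCH code $\mathcal{C}_{(q,n,\delta,b,\beta)}$ is the cyclic code of length $n$ over $\mathbb{F}_q$ with generator polynomial $\mathrm{lcm}\{m_{\beta^b}(x),\dots,m_{\beta^{b+\delta-2}}(x)\}$. *)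

theory Defs
  imports
    "Jordan_Normal_Form.VS_Connect"
    "HOL-Algebra.QuotRing"
    "HOL-Computational_Algebra.Polynomial_Factorial"
    "HOL-Library.Cardinality"
begin

section \<open>Linear codes\<close>

definition hamming_dist :: "'a vec \<Rightarrow> 'a vec \<Rightarrow> nat" where
  "hamming_dist u v = card {i. i < dim_vec u \<and> u $ i \<noteq> v $ i}"

text \<open>The set below is finite for \<open>C \<subseteq> carrier_vec N\<close>. It is empty, and the minimum
  unspecified, if \<open>C\<close> has at most one element.\<close>

definition min_distance :: "'a vec set \<Rightarrow> nat" where
  "min_distance C = Min {hamming_dist u v | u v. u \<in> C \<and> v \<in> C \<and> u \<noteq> v}"

text \<open>\<open>C\<close> is an \<open>[N, k, d]\<close> code over the field \<open>'a\<close>. For the dimension, \<open>C\<close>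
  is made a vector space by restricting the carrier of \<open>'a\<^sup>N\<close> to \<open>C\<close>.\<close>

definition is_code :: "nat \<Rightarrow> nat \<Rightarrow> nat \<Rightarrow> 'a::field vec set \<Rightarrow> bool" where
  "is_code N k d C \<longleftrightarrow>
     VectorSpace.subspace class_ring C (module_vec TYPE('a) N) \<and>
     vectorspace.dim class_ring ((module_vec TYPE('a) N)\<lparr>carrier := C\<rparr>) = k \<and>
     min_distance C = d"

definition euclidean_dual :: "nat \<Rightarrow> 'a::field vec set \<Rightarrow> 'a vec set" where
  "euclidean_dual N C = {c \<in> carrier_vec N. \<forall>y\<in>C. c \<bullet> y = 0}"

definition euclidean_self_dual :: "nat \<Rightarrow> 'a::field vec set \<Rightarrow> bool" where
  "euclidean_self_dual N C \<longleftrightarrow> C = euclidean_dual N C"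


section \<open>Cyclic codes as ideals of \<open>F[x]/\<langle>x\<^sup>N - 1\<rangle>\<close>\<close>

text \<open>\<open>class_ring :: 'a poly ring\<close> is the polynomial ring as a record; elements of the quotient
  ring are cosets.\<close>

definition cyclic_modulus :: "nat \<Rightarrow> 'a::field poly set" where
  "cyclic_modulus N = PIdl\<^bsub>class_ring\<^esub> (monom 1 N - 1)"

definition cyclic_ring :: "nat \<Rightarrow> 'a::field poly set ring" where
  "cyclic_ring N = class_ring Quot cyclic_modulus N"

definition poly_class :: "nat \<Rightarrow> 'a::field poly \<Rightarrow> 'a poly set" where
  "poly_class N p = cyclic_modulus N +>\<^bsub>class_ring\<^esub> p"

text \<open>\<open>Poly [c\<^sub>0, \<dots>, c\<^sub>m]\<close> is \<open>c\<^sub>0 + c\<^sub>1 x + \<dots> + c\<^sub>m x\<^sup>m\<close>.\<close>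

definition word_class :: "nat \<Rightarrow> 'a::field vec \<Rightarrow> 'a poly set" where
  "word_class N c = poly_class N (Poly (list_of_vec c))"

definition is_cyclic_code :: "nat \<Rightarrow> 'a::field vec set \<Rightarrow> bool" where
  "is_cyclic_code N C \<longleftrightarrow> C \<subseteq> carrier_vec N \<and> ideal (word_class N ` C) (cyclic_ring N)"

definition cyclic_code :: "nat \<Rightarrow> 'a::field poly \<Rightarrow> 'a vec set" where
  "cyclic_code N g =
     {c \<in> carrier_vec N. word_class N c \<in> PIdl\<^bsub>cyclic_ring N\<^esub> (poly_class N g)}"

definition is_generator_poly :: "nat \<Rightarrow> 'a::field vec set \<Rightarrow> 'a poly \<Rightarrow> bool" where
  "is_generator_poly N C g \<longleftrightarrow>
     lead_coeff g = 1 \<and> g dvd monom 1 N - 1 \<and> C = cyclic_code N g"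

definition generator_poly :: "nat \<Rightarrow> 'a::field vec set \<Rightarrow> 'a poly" where
  "generator_poly N C = (THE g. is_generator_poly N C g)"


section \<open>BCH codes\<close>

definition primitive_root_of_unity :: "nat \<Rightarrow> 'b::field \<Rightarrow> bool" where
  "primitive_root_of_unity n \<beta> \<longleftrightarrow>
     0 < n \<and> \<beta> ^ n = 1 \<and> (\<forall>k. 0 < k \<and> k < n \<longrightarrow> \<beta> ^ k \<noteq> 1)"

text \<open>Field extensions are given by an embedding \<open>\<phi> :: 'a \<Rightarrow> 'b\<close> of the ground field.\<close>

definition is_minimal_poly :: "('a::field \<Rightarrow> 'b::field) \<Rightarrow> 'b \<Rightarrow> 'a poly \<Rightarrow> bool" where
  "is_minimal_poly \<phi> x p \<longleftrightarrow>
     lead_coeff p = 1 \<and> poly (map_poly \<phi> p) x = 0 \<and>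
     (\<forall>r. r \<noteq> 0 \<and> poly (map_poly \<phi> r) x = 0 \<longrightarrow> degree p \<le> degree r)"

definition minimal_poly :: "('a::field \<Rightarrow> 'b::field) \<Rightarrow> 'b \<Rightarrow> 'a poly" where
  "minimal_poly \<phi> x = (THE p. is_minimal_poly \<phi> x p)"

text \<open>The class \<open>field_gcd\<close> only supplies the gcd and lcm operations that the library requires
  for \<open>Lcm\<close> on polynomials; its axioms determine them, so it does not restrict the field, and
  \<open>Lcm\<close> of nonzero polynomials is monic.\<close>

definition bch_code ::
  "('a::field_gcd \<Rightarrow> 'b::field) \<Rightarrow> nat \<Rightarrow> int \<Rightarrow> int \<Rightarrow> 'b \<Rightarrow> 'a vec set" where
  "bch_code \<phi> n \<delta> b \<beta> =
     cyclic_code n (Lcm ((\<lambda>i. minimal_poly \<phi> (\<beta> powi i)) ` {b..b + \<delta> - 2}))"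

text \<open>\<open>x\<^bsup>deg h\<^esup> h(x\<^sup>-\<^sup>1) / h(0)\<close>\<close>

definition monic_reciprocal :: "'a::field poly \<Rightarrow> 'a poly" where
  "monic_reciprocal h = Polynomial.smult (inverse (poly h 0)) (reflect_poly h)"

end

theory Submission
  imports Defs "Jordan_Normal_Form.Char_Poly"
begin

text \<open>Over the extension field, \<open>g\<close> vanishes exactly at the conjugates of \<open>\<beta>, \<dots>, \<beta>\<^sup>d\<close> with
  \<open>d = \<delta> - 1\<close>, and \<open>i + j q\<^sup>l\<close> is never divisible by \<open>n\<close> for \<open>i \<le> d\<close>, \<open>1 \<le> j \<le> d\<close>. So
  \<open>g\<close> has no zero \<open>\<beta>\<^bsup>-i\<^esup>\<close> with \<open>i \<le> d\<close>, which makes \<open>1, \<beta>, \<dots>, \<beta>\<^sup>d\<close> zeros of \<open>g\<^sup>\<bottom>\<close> and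
  \<open>\<beta>, \<dots>, \<beta>\<^sup>d\<close> double zeros of \<open>g g\<^sup>\<bottom>\<close>. The distance bound is then the BCH bound, applied to
  the two halves of a word of length \<open>2n\<close>. In characteristic \<open>2\<close> one has
  \<open>x\<^bsup>2n\<^esup> - 1 = (x\<^sup>n - 1)\<^sup>2\<close>, so the check polynomial of \<open>\<C>'\<close> is \<open>h\<close> times the reciprocal of \<open>g\<close>,
  whose reciprocal is \<open>g g\<^sup>\<bottom>\<close>; this is self-duality.\<close>

subsection \<open>Cyclic codes in terms of divisibility\<close>

definition word_poly :: "'a::field vec \<Rightarrow> 'a poly" where
  "word_poly c = Poly (list_of_vec c)"

text \<open>Coefficients from position \<open>N\<close> on are dropped, so this inverts
  \<open>word_poly\<close> only on polynomials of degree below \<open>N\<close>.\<close>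

definition poly_word :: "nat \<Rightarrow> 'a::field poly \<Rightarrow> 'a vec" where
  "poly_word N p = vec N (coeff p)"

lemma coeff_word_poly: "coeff (word_poly c) i = (if i < dim_vec c then c $ i else 0)"
  by (simp add: word_poly_def nth_default_def list_of_vec_index)

lemma poly_word_carrier [simp]: "poly_word N p \<in> carrier_vec N"
  by (simp add: poly_word_def)

lemma poly_word_word_poly: "c \<in> carrier_vec N \<Longrightarrow> poly_word N (word_poly c) = c"
  by (intro eq_vecI) (auto simp: poly_word_def coeff_word_poly)

lemma word_poly_poly_word:
  assumes "p = 0 \<or> degree p < N"
  shows "word_poly (poly_word N p) = p"
  using assms by (intro poly_eqI) (auto simp: poly_word_def coeff_word_poly coeff_eq_0)

lemma degree_word_poly:
  assumes "c \<in> carrier_vec N" "0 < N"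
  shows "degree (word_poly c) < N"
proof -
  have "degree (word_poly c) \<le> N - 1"
    using assms by (intro degree_le) (auto simp: coeff_word_poly)
  then show ?thesis using assms by simp
qed

abbreviation (input) xn1 :: "nat \<Rightarrow> 'a::comm_ring_1 poly" where
  "xn1 N \<equiv> monom 1 N - 1"

lemma coeff_xn1: "coeff (xn1 N :: 'a::field poly) i = (if i = N then 1 else 0) - (if i = 0 then 1 else 0)"
  by (auto simp: coeff_diff)

lemma degree_xn1: "degree (xn1 N :: 'a::field poly) = N"
proof (cases "N = 0")
  case False
  then show ?thesis
    by (intro antisym degree_le le_degree) (auto simp: coeff_xn1)
qed simp

lemma xn1_nonzero: "0 < N \<Longrightarrow> (xn1 N :: 'a::field poly) \<noteq> 0"
  using degree_xn1[of N, where 'a='a] by (metis degree_0 less_numeral_extra(3))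

lemma cyclic_modulus_eq: "cyclic_modulus N = {p :: 'a::field poly. xn1 N dvd p}"
  by (auto simp: cyclic_modulus_def cgenideal_def dvd_def mult.commute)

lemma poly_class_eq: "poly_class N p = {r :: 'a::field poly. xn1 N dvd r - p}"
  unfolding poly_class_def a_r_coset_def' cyclic_modulus_eq
proof (intro equalityI subsetI; clarsimp)
  fix r assume "xn1 N dvd r - p"
  then show "\<exists>h. xn1 N dvd h \<and> r = h + p"
    by (intro exI[of _ "r - p"]) simp
qed

lemma poly_class_eq_iff: "poly_class N p = poly_class N (r :: 'a::field poly) \<longleftrightarrow> xn1 N dvd p - r"
proof
  assume "poly_class N p = poly_class N r"
  moreover have "p \<in> poly_class N p" by (simp add: poly_class_eq)
  ultimately show "xn1 N dvd p - r" by (simp add: poly_class_eq)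
next
  assume d: "xn1 N dvd p - r"
  have "xn1 N dvd s - p \<longleftrightarrow> xn1 N dvd s - r" for s
    using dvd_add_left_iff[OF d, of "s - p"] by simp
  then show "poly_class N p = poly_class N r" by (simp add: poly_class_eq)
qed

lemma ideal_cyclic_modulus: "ideal (cyclic_modulus N) (class_ring :: 'a::field poly ring)"
  unfolding cyclic_modulus_def by (rule cring.cgenideal_ideal[OF class_cring.cring_axioms]) simp

lemma cring_cyclic_ring: "cring (cyclic_ring N :: 'a::field poly set ring)"
  unfolding cyclic_ring_def
  by (rule ideal.quotient_is_cring[OF ideal_cyclic_modulus class_cring.is_cring])

lemma carrier_cyclic_ring: "carrier (cyclic_ring N) = range (poly_class N :: 'a::field poly \<Rightarrow> _)"
  by (auto simp: cyclic_ring_def FactRing_def A_RCOSETS_def' poly_class_def)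

lemma poly_class_mult:
  "poly_class N p \<otimes>\<^bsub>cyclic_ring N\<^esub> poly_class N r = poly_class N (p * r :: 'a::field poly)"
  using ideal.rcoset_mult_add[OF ideal_cyclic_modulus, of p r N]
  by (simp add: cyclic_ring_def FactRing_def poly_class_def)

lemma PIdl_cyclic_ring:
  "PIdl\<^bsub>cyclic_ring N\<^esub> (poly_class N g) = range (\<lambda>f. poly_class N (f * g :: 'a::field poly))"
  unfolding cgenideal_def carrier_cyclic_ring
  by (auto simp: poly_class_mult) (metis poly_class_mult rangeI)

text \<open>Because \<open>g\<close> divides the modulus, divisibility by \<open>g\<close> is the
  same for all representatives of a coset. From here on, codes are handled through divisibility
  instead of the quotient ring.\<close>

lemma mem_cyclic_code_iff:
  assumes "g dvd xn1 N"
  shows "c \<in> cyclic_code N g \<longleftrightarrow> c \<in> carrier_vec N \<and> g dvd word_poly c"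
proof -
  have "word_class N c \<in> PIdl\<^bsub>cyclic_ring N\<^esub> (poly_class N g) \<longleftrightarrow> g dvd word_poly c"
  proof
    assume "word_class N c \<in> PIdl\<^bsub>cyclic_ring N\<^esub> (poly_class N g)"
    then obtain f where "xn1 N dvd word_poly c - f * g"
      by (auto simp: PIdl_cyclic_ring word_class_def word_poly_def poly_class_eq_iff)
    with assms have "g dvd word_poly c - f * g" by (rule dvd_trans)
    then show "g dvd word_poly c" by (metis diff_add_cancel dvd_add dvd_triv_right)
  next
    assume "g dvd word_poly c"
    then obtain f where "word_poly c = f * g" by (auto simp: dvd_def mult.commute)
    then show "word_class N c \<in> PIdl\<^bsub>cyclic_ring N\<^esub> (poly_class N g)"
      by (auto simp: PIdl_cyclic_ring word_class_def word_poly_def)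
  qed
  then show ?thesis by (auto simp: cyclic_code_def)
qed

lemma poly_word_mod_in_cyclic_code:
  assumes "g dvd xn1 N" "g dvd p" "0 < N"
  shows "word_poly (poly_word N (p mod xn1 N)) = p mod xn1 N"
    and "poly_word N (p mod xn1 N) \<in> cyclic_code N g"
proof -
  show *: "word_poly (poly_word N (p mod xn1 N)) = p mod xn1 N"
    using degree_mod_less[OF xn1_nonzero[OF assms(3)], of p]
    by (intro word_poly_poly_word) (auto simp: degree_xn1)
  show "poly_word N (p mod xn1 N) \<in> cyclic_code N g"
    using assms by (simp add: mem_cyclic_code_iff * dvd_mod)
qed

text \<open>Every element of the principal ideal is the class of some \<open>f * g\<close>; its
  remainder modulo \<open>xn1 N\<close> has degree below \<open>N\<close> and is still a multiple of
  \<open>g\<close>, hence comes from a word of the code.\<close>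

lemma is_cyclic_code_cyclic_code:
  assumes "g dvd xn1 N" "0 < N"
  shows "is_cyclic_code N (cyclic_code N (g :: 'a::field poly))"
proof -
  have "word_class N ` cyclic_code N g = PIdl\<^bsub>cyclic_ring N\<^esub> (poly_class N g)"
  proof (intro equalityI subsetI)
    fix x assume "x \<in> PIdl\<^bsub>cyclic_ring N\<^esub> (poly_class N g)"
    then obtain f where f: "x = poly_class N (f * g)" by (auto simp: PIdl_cyclic_ring)
    let ?c = "poly_word N (f * g mod xn1 N)"
    have "word_class N ?c = poly_class N (f * g mod xn1 N)"
      using poly_word_mod_in_cyclic_code(1)[OF assms(1) dvd_triv_right assms(2), of f]
      by (simp add: word_class_def word_poly_def)
    also have "\<dots> = x"
      unfolding f poly_class_eq_iff by (metis dvd_minus_mod minus_diff_eq dvd_minus_iff)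
    finally show "x \<in> word_class N ` cyclic_code N g"
      using poly_word_mod_in_cyclic_code(2)[OF assms(1) dvd_triv_right assms(2), of f] by blast
  qed (auto simp: cyclic_code_def)
  moreover have "ideal (PIdl\<^bsub>cyclic_ring N\<^esub> (poly_class N g)) (cyclic_ring N)"
    by (rule cring.cgenideal_ideal[OF cring_cyclic_ring]) (simp add: carrier_cyclic_ring)
  ultimately show ?thesis
    by (auto simp: is_cyclic_code_def cyclic_code_def)
qed

text \<open>Each generator, reduced modulo \<open>xn1 N\<close>, is a word of the common code, so
  the two divide each other. The reduction matters for \<open>g = xn1 N\<close>, whose degree is too
  large for a word.\<close>

lemma generator_poly_unique:
  assumes "is_generator_poly N C g" "is_generator_poly N C g'" "0 < N"
  shows "g = (g' :: 'a::field poly)"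
proof -
  have *: "b dvd a" if "is_generator_poly N C a" "is_generator_poly N C b" for a b :: "'a poly"
  proof -
    from that have d: "a dvd xn1 N" "b dvd xn1 N" and C: "C = cyclic_code N a" "C = cyclic_code N b"
      by (auto simp: is_generator_poly_def)
    have "poly_word N (a mod xn1 N) \<in> cyclic_code N b"
      using poly_word_mod_in_cyclic_code(2)[OF d(1) dvd_refl assms(3)] C by simp
    then have "b dvd a mod xn1 N"
      using d by (simp add: mem_cyclic_code_iff poly_word_mod_in_cyclic_code(1)[OF d(1) dvd_refl assms(3)])
    then show "b dvd a" using d(2) by (simp add: dvd_mod_iff)
  qed
  show ?thesis
    using *[OF assms(1,2)] *[OF assms(2,1)] assms(1,2)
    by (intro poly_dvd_antisym) (auto simp: is_generator_poly_def)
qed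

lemma generator_poly_cyclic_code:
  assumes "monic g" "g dvd xn1 N" "0 < N"
  shows "generator_poly N (cyclic_code N g) = (g :: 'a::field poly)"
  unfolding generator_poly_def
  using assms generator_poly_unique by (intro the_equality) (auto simp: is_generator_poly_def)

subsection \<open>Reciprocal polynomials\<close>

lemma monic_reciprocal_mult:
  "monic_reciprocal (p * r :: 'a::field poly) = monic_reciprocal p * monic_reciprocal r"
  by (simp add: monic_reciprocal_def reflect_poly_mult mult.commute)

lemma degree_monic_reciprocal:
  "poly p 0 \<noteq> 0 \<Longrightarrow> degree (monic_reciprocal (p :: 'a::field poly)) = degree p"
  by (simp add: monic_reciprocal_def poly_0_coeff_0)

lemma monic_monic_reciprocal:
  assumes "poly p 0 \<noteq> 0"
  shows "monic (monic_reciprocal (p :: 'a::field poly))"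
proof -
  have "coeff (monic_reciprocal p) (degree p) = 1"
    using assms by (simp add: monic_reciprocal_def coeff_reflect_poly poly_0_coeff_0)
  then show ?thesis by (simp add: degree_monic_reciprocal[OF assms])
qed

lemma monic_reciprocal_monic_reciprocal:
  assumes "monic p" "poly p 0 \<noteq> 0"
  shows "monic_reciprocal (monic_reciprocal (p :: 'a::field poly)) = p"
  using assms by (simp add: monic_reciprocal_def reflect_poly_smult poly_0_coeff_0)

text \<open>Reflection changes the sign of \<open>xn1 N\<close>, and dividing by the constant term
  \<open>-1\<close> restores it.\<close>

lemma monic_reciprocal_xn1:
  assumes "0 < N"
  shows "monic_reciprocal (xn1 N) = (xn1 N :: 'a::field poly)"
proof -
  have "poly (xn1 N :: 'a poly) 0 = -1" using assms by (simp add: poly_monom)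
  moreover have "reflect_poly (xn1 N :: 'a poly) = - xn1 N"
    using assms
    by (intro poly_eqI)
      (auto simp: coeff_reflect_poly degree_xn1 coeff_xn1 simp del: coeff_diff minus_diff_eq)
  ultimately show ?thesis by (simp add: monic_reciprocal_def)
qed

lemma poly_monic_reciprocal_eq_0_iff:
  assumes "poly p 0 \<noteq> 0" "x \<noteq> 0"
  shows "poly (monic_reciprocal (p :: 'a::field poly)) x = 0 \<longleftrightarrow> poly p (inverse x) = 0"
  using assms by (simp add: monic_reciprocal_def poly_reflect_poly_nz)

lemma poly_0_neq_0_if_dvd_xn1:
  assumes "g dvd xn1 N" "0 < N"
  shows "poly (g :: 'a::field poly) 0 \<noteq> 0"
proof
  assume "poly g 0 = 0"
  then have "poly (xn1 N :: 'a poly) 0 = 0" using poly_hom.hom_dvd[OF assms(1), of 0] by simp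
  then show False using assms(2) by (simp add: poly_monom power_0_left)
qed

text \<open>For \<open>degree p < N\<close> this is \<open>x^(N-1) p(1/x)\<close>, the reversal of a
  word of fixed length \<open>N\<close>. \<open>reflect_poly\<close> alone reverses relative to the
  degree, so the monomial supplies the missing shift.\<close>

definition reverse_poly :: "nat \<Rightarrow> 'a::field poly \<Rightarrow> 'a poly" where
  "reverse_poly N p = monom 1 (N - 1 - degree p) * reflect_poly p"

lemma coeff_reverse_poly:
  assumes "degree p < N"
  shows "coeff (reverse_poly N p) i = (if i < N then coeff p (N - 1 - i) else 0)"
proof (cases "i < N - 1 - degree p")
  case True
  then show ?thesis by (auto simp: reverse_poly_def coeff_monom_mult coeff_eq_0)
next
  case False
  show ?thesis
  proof (cases "i < N")
    case True
    with False assms have "degree p - (i - (N - 1 - degree p)) = N - 1 - i" by simp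
    then show ?thesis using False True by (simp add: reverse_poly_def coeff_monom_mult coeff_reflect_poly)
  next
    case False
    then show ?thesis using assms by (auto simp: reverse_poly_def coeff_monom_mult coeff_reflect_poly)
  qed
qed

text \<open>Reflection forgets the factor \<open>x^j\<close> and is an involution on the remaining
  factor \<open>r\<close>; the split separates the two effects.\<close>

lemma monom_factor:
  assumes "p \<noteq> 0"
  obtains j r where "p = monom 1 j * (r :: 'a::field poly)" "poly r 0 \<noteq> 0"
proof -
  obtain r where r: "p = [:- 0, 1:] ^ order 0 p * r" "\<not> [:- 0, 1:] dvd r"
    using order_decomp[OF assms, of 0] by blast
  have "[:- 0, 1:] ^ order 0 p = (monom 1 (order 0 p) :: 'a poly)"
    by (simp add: monom_altdef)
  then show ?thesis
    using that[of "order 0 p" r] r by (simp add: poly_eq_0_iff_dvd)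
qed

lemma reflect_poly_monom_1: "reflect_poly (monom 1 j :: 'a::field poly) = 1"
  by (induction j) (simp_all add: monom_0 monom_Suc reflect_poly_pCons')

text \<open>Reflection is multiplicative and sends powers of \<open>x\<close> to 1. Since
  \<open>h\<close> has a nonzero constant term, reflecting twice gives it back, and the powers of
  \<open>x\<close> lost or added do not affect divisibility.\<close>

lemma dvd_reverse_poly_iff:
  assumes h: "poly h 0 \<noteq> 0"
  shows "(h :: 'a::field poly) dvd reverse_poly N p \<longleftrightarrow> monic_reciprocal h dvd p"
proof (cases "p = 0")
  case False
  then obtain j r where p: "p = monom 1 j * r" and r: "poly r 0 \<noteq> 0" by (rule monom_factor)
  have rr: "reflect_poly p = reflect_poly r" "reflect_poly (reflect_poly r) = r"
      "reflect_poly (reflect_poly h) = h"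
    using r h by (simp_all add: p reflect_poly_mult reflect_poly_monom_1 poly_0_coeff_0)
  have "h dvd reverse_poly N p \<longleftrightarrow> reflect_poly h dvd p"
  proof
    assume "h dvd reverse_poly N p"
    then have "h dvd monom 1 (N - 1 - degree p) * reflect_poly r"
      by (simp add: reverse_poly_def rr)
    then obtain u where "monom 1 (N - 1 - degree p) * reflect_poly r = h * u"
      by (rule dvdE)
    then have "reflect_poly (monom 1 (N - 1 - degree p) * reflect_poly r) = reflect_poly (h * u)"
      by simp
    then have "r = reflect_poly h * reflect_poly u"
      by (simp add: reflect_poly_mult reflect_poly_monom_1 rr)
    then show "reflect_poly h dvd p" by (simp add: p)
  next
    assume "reflect_poly h dvd p"
    then obtain u where "p = reflect_poly h * u" by (rule dvdE)
    then have "reflect_poly p = h * reflect_poly u" by (simp add: reflect_poly_mult rr)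
    then show "h dvd reverse_poly N p" by (simp add: reverse_poly_def)
  qed
  then show ?thesis using h by (simp add: monic_reciprocal_def smult_dvd_iff)
qed (simp add: reverse_poly_def)

subsection \<open>Duals of cyclic codes\<close>

text \<open>Reversing one word turns the scalar product into a convolution, so orthogonality becomes
  the vanishing of one coefficient of a product.\<close>

lemma scalar_prod_eq_coeff:
  assumes "c \<in> carrier_vec N" "y \<in> carrier_vec N" "0 < N"
  shows "c \<bullet> y = coeff (word_poly y * reverse_poly N (word_poly c)) (N - 1)"
proof -
  have d: "degree (word_poly c) < N" using degree_word_poly assms by blast
  have "coeff (word_poly y * reverse_poly N (word_poly c)) (N - 1)
      = (\<Sum>i\<le>N - 1. y $ i * c $ i)"
    unfolding coeff_mult using assms
    by (intro sum.cong refl) (auto simp: coeff_reverse_poly[OF d] coeff_word_poly)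
  also have "{..N - 1} = {0..<N}" using assms by auto
  finally show ?thesis using assms by (simp add: scalar_prod_def mult.commute)
qed

lemma poly_cutoff_shift: "(p :: 'a::field poly) = poly_cutoff n p + monom 1 n * poly_shift n p"
  by (intro poly_eqI) (auto simp: coeff_poly_cutoff coeff_poly_shift coeff_monom_mult)

lemma dvd_imp_eq_0:
  assumes "(g :: 'a::field poly) dvd p" "\<And>i. degree g \<le> i \<Longrightarrow> coeff p i = 0"
  shows "p = 0"
  using assms by (metis dvd_imp_degree_le leading_coeff_0_iff)

text \<open>With \<open>R\<close> the reversal of \<open>c\<close>, membership on the right means
  \<open>h dvd R\<close>, that is, \<open>g * R\<close> is a multiple of \<open>xn1 N\<close>. One
  direction is a degree count; the other tests \<open>c\<close> against the shifts of
  \<open>g\<close>.\<close>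

lemma euclidean_dual_cyclic_code:
  assumes gh: "g * h = xn1 N" and N: "0 < N"
  shows "euclidean_dual N (cyclic_code N g) = cyclic_code N (monic_reciprocal (h :: 'a::field poly))"
proof -
  have g: "g dvd xn1 N" using gh by (metis dvd_triv_left)
  have h: "h dvd xn1 N" using gh by (metis dvd_triv_right)
  have mr: "monic_reciprocal h dvd xn1 N"
    using arg_cong[OF gh, of monic_reciprocal] monic_reciprocal_xn1[OF N, where 'a='a]
    by (metis dvd_triv_right monic_reciprocal_mult)
  have h0: "poly h 0 \<noteq> 0" by (rule poly_0_neq_0_if_dvd_xn1[OF h N])
  have nz: "g \<noteq> 0" "h \<noteq> 0" using gh xn1_nonzero[OF N, where 'a='a] by auto
  show ?thesis
  proof (intro equalityI subsetI)
    fix c assume c: "c \<in> cyclic_code N (monic_reciprocal h)"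
    then have cN: "c \<in> carrier_vec N" by (simp add: mem_cyclic_code_iff[OF mr])
    define R where "R = reverse_poly N (word_poly c)"
    have "h dvd R"
      using c by (simp add: R_def dvd_reverse_poly_iff[OF h0] mem_cyclic_code_iff[OF mr])
    then obtain w where w: "R = h * w" by (rule dvdE)
    have dc: "degree (word_poly c) < N" using degree_word_poly[OF cN N] .
    have dR: "degree R \<le> N - 1" 
      by (rule degree_le) (auto simp: R_def coeff_reverse_poly[OF dc])
    have "c \<bullet> y = 0" if y: "y \<in> cyclic_code N g" for y
    proof -
      from y have yN: "y \<in> carrier_vec N" and "g dvd word_poly y"
        by (simp_all add: mem_cyclic_code_iff[OF g])
      then obtain v where v: "word_poly y = g * v" by (elim dvdE)
      have eq: "word_poly y * R = xn1 N * (v * w)" by (simp add: v w gh[symmetric])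
      \<comment> \<open>The product of the two words has degree below \<open>2 * N - 1\<close>, so
        the cofactor of \<open>xn1 N\<close> has degree below \<open>N - 1\<close>.\<close>
      have "coeff (v * w) (N - 1) = 0"
      proof (cases "v * w = 0")
        case False
        have "N + degree (v * w) = degree (word_poly y * R)"
          unfolding eq degree_mult_eq[OF xn1_nonzero[OF N] False] degree_xn1 ..
        also have "\<dots> \<le> degree (word_poly y) + degree R" by (rule degree_mult_le)
        also have "\<dots> < N + (N - 1)" using degree_word_poly[OF yN N] dR by simp
        finally show ?thesis by (intro coeff_eq_0) simp
      qed auto
      then have "coeff (word_poly y * R) (N - 1) = 0"
        unfolding eq using N by (simp add: left_diff_distrib coeff_monom_mult)
      then show ?thesis using scalar_prod_eq_coeff[OF cN yN N] by (simp add: R_def)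
    qed
    then show "c \<in> euclidean_dual N (cyclic_code N g)" using cN by (simp add: euclidean_dual_def)
  next
    fix c assume "c \<in> euclidean_dual N (cyclic_code N g)"
    then have cN: "c \<in> carrier_vec N" and orth: "\<And>y. y \<in> cyclic_code N g \<Longrightarrow> c \<bullet> y = 0"
      by (auto simp: euclidean_dual_def)
    define R where "R = reverse_poly N (word_poly c)"
    have dc: "degree (word_poly c) < N" using degree_word_poly[OF cN N] .
    have dR: "degree R \<le> N - 1" 
      by (rule degree_le) (auto simp: R_def coeff_reverse_poly[OF dc])
    let ?W = "g * R"
    \<comment> \<open>The shift of \<open>g\<close> by \<open>N - 1 - i\<close> moves coefficient
      \<open>i\<close> of \<open>g * R\<close> to position \<open>N - 1\<close>;
      \<open>degree g \<le> i\<close> keeps the shifted polynomial a word of length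
      \<open>N\<close>.\<close>
    have zero: "coeff ?W i = 0" if i: "degree g \<le> i" "i < N" for i
    proof -
      let ?v = "monom 1 (N - 1 - i) * g"
      let ?y = "poly_word N ?v"
      have "degree ?v < N" using i nz by (simp add: degree_mult_eq degree_monom_eq)
      then have wp: "word_poly ?y = ?v" by (intro word_poly_poly_word) simp
      then have "?y \<in> cyclic_code N g" by (simp add: mem_cyclic_code_iff[OF g])
      then have "c \<bullet> ?y = 0" by (rule orth)
      then have "coeff (?v * R) (N - 1) = 0"
        unfolding scalar_prod_eq_coeff[OF cN poly_word_carrier N] wp R_def .
      moreover have "N - 1 - (N - 1 - i) = i" using i by simp
      ultimately show ?thesis by (simp only: mult.assoc coeff_monom_mult diff_le_self if_True mult_1)
    qed
    let ?A = "poly_cutoff N ?W" and ?B = "poly_shift N ?W"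
    \<comment> \<open>Modulo \<open>xn1 N\<close> the upper part wraps around onto the lower one.
      The sum \<open>?A + ?B\<close> is a multiple of \<open>g\<close> without coefficients from
      \<open>degree g\<close> on, hence zero.\<close>
    have W: "?W = (?A + ?B) + xn1 N * ?B"
      using poly_cutoff_shift[of ?W N] by (simp add: algebra_simps)
    have "g dvd ?A + ?B"
      using W g by (metis dvd_add_left_iff dvd_mult2 dvd_triv_left)
    moreover have "coeff (?A + ?B) i = 0" if i: "degree g \<le> i" for i
    proof -
      have "degree ?W \<le> degree g + (N - 1)" using degree_mult_le[of g R] dR by simp
      then have "coeff ?W (i + N) = 0" using i N by (intro coeff_eq_0) simp
      then show ?thesis using zero[OF i] by (auto simp: coeff_poly_cutoff coeff_poly_shift)
    qed
    ultimately have "?A + ?B = 0" by (rule dvd_imp_eq_0)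
    with W have "?W = g * (h * ?B)" by (metis add_0 gh mult.assoc)
    then have "R = h * ?B" using nz by simp
    then have "h dvd R" by (metis dvd_triv_left)
    then show "c \<in> cyclic_code N (monic_reciprocal h)"
      using cN by (simp add: mem_cyclic_code_iff[OF mr] R_def dvd_reverse_poly_iff[OF h0])
  qed
qed

text \<open>Multiplication by \<open>g\<close> is a linear injection \<open>T\<close> from
  \<open>k = N - degree g\<close> message coordinates onto the code, so the code is its image and
  rank-nullity gives the dimension.\<close>

lemma subspace_dim_cyclic_code:
  fixes g :: "'a::field poly"
  assumes g: "g dvd xn1 N" and N: "0 < N"
  shows "VectorSpace.subspace class_ring (cyclic_code N g) (module_vec TYPE('a) N)" (is ?sub)
    and "vectorspace.dim class_ring ((module_vec TYPE('a) N)\<lparr>carrier := cyclic_code N g\<rparr>)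
      = N - degree g" (is ?dim)
proof -
  define k where "k = N - degree g"
  define T where "T = (\<lambda>v. poly_word N (g * word_poly v))"
  have nz: "g \<noteq> 0" using g xn1_nonzero[OF N, where 'a='a] by auto
  have dg: "degree g \<le> N"
    using dvd_imp_degree_le[OF g xn1_nonzero[OF N]] by (simp add: degree_xn1)
  have deg: "g * word_poly v = 0 \<or> degree (g * word_poly v) < N" if v: "v \<in> carrier_vec k" for v
  proof (cases "word_poly v = 0")
    case False
    then have "0 < k" using v by (auto simp: poly_eq_iff coeff_word_poly split: if_splits)
    then show ?thesis
      using degree_word_poly[OF v] dg False nz by (auto simp: degree_mult_eq k_def)
  qed simp
  have wT: "word_poly (T v) = g * word_poly v" if "v \<in> carrier_vec k" for v
    unfolding T_def using deg[OF that] by (rule word_poly_poly_word)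
  have add: "word_poly (u + v) = word_poly u + word_poly v"
    if "u \<in> carrier_vec k" "v \<in> carrier_vec k" for u v :: "'a vec"
    using that by (intro poly_eqI) (auto simp: coeff_word_poly)
  have smu: "word_poly (a \<cdot>\<^sub>v v) = Polynomial.smult a (word_poly v)"
    if "v \<in> carrier_vec k" for v :: "'a vec" and a
    using that by (intro poly_eqI) (auto simp: coeff_word_poly)
  have pw: "poly_word N (p + r) = poly_word N p + poly_word N r"
    "poly_word N (Polynomial.smult a p) = a \<cdot>\<^sub>v poly_word N p" for p r :: "'a poly" and a
    by (auto simp: poly_word_def)
  interpret V: vec_space "TYPE('a)" k .
  interpret W: vec_space "TYPE('a)" N .
  interpret T: linear_map class_ring "module_vec TYPE('a) k" "module_vec TYPE('a) N" T
  proof -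
    have "T \<in> LinearCombinations.module_hom class_ring (module_vec TYPE('a) k) (module_vec TYPE('a) N)"
      by (auto simp: LinearCombinations.module_hom_def module_vec_simps T_def add smu pw distrib_left)
    then show "linear_map class_ring (module_vec TYPE('a) k) (module_vec TYPE('a) N) T"
      by (simp add: linear_map_def mod_hom_def mod_hom_axioms_def vec_vs vec_module)
  qed
  have imT: "T.im = T ` carrier_vec k" by (simp add: T.im_def module_vec_simps)
  have TN: "T v \<in> carrier_vec N" for v by (simp add: T_def)
  have im: "T.im = cyclic_code N g"
  proof (intro equalityI subsetI)
    fix c assume c: "c \<in> cyclic_code N g"
    then have cN: "c \<in> carrier_vec N" by (simp add: mem_cyclic_code_iff[OF g])
    from c have "g dvd word_poly c" by (simp add: mem_cyclic_code_iff[OF g])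
    then obtain u where u: "word_poly c = g * u" by (rule dvdE)
    have "u = 0 \<or> degree u < k"
      using degree_word_poly[OF cN N] nz by (cases "u = 0") (auto simp: u degree_mult_eq k_def)
    then have "word_poly (poly_word k u) = u" by (rule word_poly_poly_word)
    then have "T (poly_word k u) = c" 
      using poly_word_word_poly[OF cN] by (simp add: T_def u)
    then show "c \<in> T.im" unfolding imT by (metis imageI poly_word_carrier)
  qed (auto simp: imT mem_cyclic_code_iff[OF g] wT TN)
  have "inj_on T (carrier_vec k)"
  proof (rule inj_onI)
    fix u v assume uv: "u \<in> carrier_vec k" "v \<in> carrier_vec k" "T u = T v"
    then have "g * word_poly u = g * word_poly v" using wT by metis
    then have "word_poly u = word_poly v" using nz by simp
    then show "u = v" using uv poly_word_word_poly by metis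
  qed
  then have "vectorspace.dim class_ring ((module_vec TYPE('a) k)\<lparr>carrier := T.ker\<rparr>) = 0"
    using T.inj_imp_dim_ker0 by (simp add: module_vec_simps)
  then show ?dim
    using T.rank_nullity[OF V.fin_dim] im V.dim_is_n by (simp add: k_def)
  show ?sub using T.imT_is_subspace im by simp
qed

subsection \<open>Weights and minimum distance\<close>

text \<open>The difference of two distinct words is a nonzero multiple of \<open>g\<close> of degree
  below \<open>N\<close>. With \<open>degree g < N\<close>, \<open>g\<close> itself is a nonzero
  word, so the minimum is not taken over the empty set.\<close>

lemma min_distance_cyclic_code_ge:
  fixes g :: "'a::field poly"
  assumes g: "g dvd xn1 N" and dg: "degree g < N"
    and wt: "\<And>p. p \<noteq> 0 \<Longrightarrow> degree p < N \<Longrightarrow> g dvd p \<Longrightarrow> D \<le> card {i. coeff p i \<noteq> 0}"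
  shows "D \<le> min_distance (cyclic_code N g)"
proof -
  let ?C = "cyclic_code N g"
  let ?S = "{hamming_dist u v | u v. u \<in> ?C \<and> v \<in> ?C \<and> u \<noteq> v}"
  have N: "0 < N" using dg by simp
  have nz: "g \<noteq> 0" using g xn1_nonzero[OF N, where 'a='a] by auto
  have hd: "hamming_dist u v \<le> N" and ge: "u \<noteq> v \<Longrightarrow> D \<le> hamming_dist u v"
    if "u \<in> ?C" "v \<in> ?C" for u v
  proof -
    from that have car: "u \<in> carrier_vec N" "v \<in> carrier_vec N"
      and d: "g dvd word_poly u" "g dvd word_poly v"
      by (simp_all add: mem_cyclic_code_iff[OF g])
    have "card {i. i < N \<and> u $ i \<noteq> v $ i} \<le> card {..<N}" by (rule card_mono) auto
    then show "hamming_dist u v \<le> N" using car by (simp add: hamming_dist_def)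
    let ?p = "word_poly u - word_poly v"
    assume "u \<noteq> v"
    then have "?p \<noteq> 0" using car poly_word_word_poly by (metis eq_iff_diff_eq_0)
    moreover have "degree ?p < N"
      using degree_word_poly[OF _ N] car by (intro degree_diff_less) auto
    moreover have "g dvd ?p" using d by (rule dvd_diff)
    ultimately have "D \<le> card {i. coeff ?p i \<noteq> 0}" by (rule wt)
    also have "{i. coeff ?p i \<noteq> 0} = {i. i < dim_vec u \<and> u $ i \<noteq> v $ i}"
      using car by (auto simp: coeff_word_poly)
    finally show "D \<le> hamming_dist u v" by (simp add: hamming_dist_def)
  qed
  have wg: "word_poly (poly_word N g) = g" using dg by (intro word_poly_poly_word) simp
  then have mem: "poly_word N g \<in> ?C" by (simp add: mem_cyclic_code_iff[OF g])
  have "word_poly (poly_word N 0) = (0 :: 'a poly)" by (intro word_poly_poly_word) simp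
  then have mem0: "poly_word N 0 \<in> ?C" by (simp add: mem_cyclic_code_iff[OF g])
  have ne: "poly_word N g \<noteq> poly_word N 0"
    using wg \<open>word_poly (poly_word N 0) = 0\<close> nz by metis
  have "?S \<subseteq> {..N}" using hd by auto
  then have "finite ?S" by (rule finite_subset) simp
  moreover have "?S \<noteq> {}" using mem mem0 ne by blast
  ultimately show ?thesis
    unfolding min_distance_def using ge by (subst Min_ge_iff) auto
qed

section \<open>Primitive roots of unity and the BCH bound\<close>

lemma primitive_root_of_unity_nonzero: "primitive_root_of_unity n \<beta> \<Longrightarrow> \<beta> \<noteq> (0 :: 'b::field)"
  by (auto simp: primitive_root_of_unity_def power_0_left)

lemma primitive_root_of_unity_dvd:
  assumes "primitive_root_of_unity n \<beta>" "\<beta> ^ k = (1 :: 'b::field)"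
  shows "n dvd k"
proof -
  have "\<beta> ^ k = (\<beta> ^ n) ^ (k div n) * \<beta> ^ (k mod n)"
    by (simp flip: power_mult power_add)
  then have "\<beta> ^ (k mod n) = 1" using assms by (simp add: primitive_root_of_unity_def)
  moreover have "k mod n < n" using assms(1) by (simp add: primitive_root_of_unity_def)
  ultimately have "k mod n = 0" using assms(1) by (auto simp: primitive_root_of_unity_def)
  then show ?thesis by auto
qed

lemma primitive_root_of_unity_inj:
  assumes \<beta>: "primitive_root_of_unity n (\<beta> :: 'b::field)"
  shows "inj_on ((^) \<beta>) {..<n}"
proof (rule linorder_inj_onI')
  fix i j assume ij: "i \<in> {..<n}" "j \<in> {..<n}" "i < j"
  show "\<beta> ^ i \<noteq> \<beta> ^ j"
  proof
    assume "\<beta> ^ i = \<beta> ^ j"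
    also have "\<beta> ^ j = \<beta> ^ i * \<beta> ^ (j - i)" using ij by (simp flip: power_add)
    finally have "\<beta> ^ (j - i) = 1" using primitive_root_of_unity_nonzero[OF \<beta>] by simp
    then show False using \<beta> ij by (auto simp: primitive_root_of_unity_def)
  qed
qed

lemma finite_poly_support: "finite {i. coeff (p :: 'b::zero poly) i \<noteq> 0}"
  by (rule finite_subset[of _ "{..degree p}"]) (auto simp: le_degree)

text \<open>Instead of a Vandermonde determinant, the proof uses the polynomial \<open>f\<close>
  that vanishes at \<open>\<beta> ^ s\<close> for every \<open>s\<close> in the support except
  \<open>s0\<close>. If the support had at most \<open>t\<close> elements, \<open>f\<close> would
  have degree below \<open>t\<close>, so the \<open>t\<close> given zeros would suffice to evaluate
  the combination.\<close>

lemma bch_bound: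
  fixes p :: "'b::field poly"
  assumes \<beta>: "primitive_root_of_unity n \<beta>" and p: "p \<noteq> 0" "degree p < n"
    and roots: "\<And>i. i < t \<Longrightarrow> poly p (\<beta> ^ (b + i)) = 0"
  shows "t < card {i. coeff p i \<noteq> 0}"
proof (rule ccontr)
  define S where "S = {i. coeff p i \<noteq> 0}"
  assume "\<not> t < card {i. coeff p i \<noteq> 0}"
  then have t: "card S \<le> t" by (simp add: S_def)
  have fin: "finite S" unfolding S_def by (rule finite_poly_support)
  have Sn: "S \<subseteq> {..<n}" using p(2) le_degree[of p] by (force simp: S_def)
  have "degree p \<in> S" using p by (simp add: S_def)
  then obtain s0 where s0: "s0 \<in> S" by blast
  define f where "f = (\<Prod>s\<in>S - {s0}. [:- (\<beta> ^ s), 1:])"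
  have "degree f = card (S - {s0})" unfolding f_def
    by (subst degree_prod_eq_sum_degree) auto
  also have "\<dots> < card S" using fin s0 by (intro psubset_card_mono) auto
  finally have df: "degree f < t" using t by simp
  have pS: "poly p x = (\<Sum>s\<in>S. coeff p s * x ^ s)" for x
    unfolding poly_altdef by (rule sum.mono_neutral_right) (auto simp: S_def le_degree)
  \<comment> \<open>Testing the vanishing power sums against \<open>f\<close> isolates the coefficient at \<open>s0\<close>.\<close>
  have "(\<Sum>s\<in>S. coeff p s * \<beta> ^ (b * s) * poly f (\<beta> ^ s))
      = (\<Sum>s\<in>S. \<Sum>i\<le>degree f. coeff f i * (coeff p s * (\<beta> ^ (b + i)) ^ s))"
    by (simp add: poly_altdef sum_distrib_left algebra_simps flip: power_mult power_add)
  also have "\<dots> = (\<Sum>i\<le>degree f. coeff f i * poly p (\<beta> ^ (b + i)))"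
    by (subst sum.swap) (simp add: pS sum_distrib_left)
  also have "\<dots> = 0" using roots df by (intro sum.neutral) auto
  finally have "(\<Sum>s\<in>S. coeff p s * \<beta> ^ (b * s) * poly f (\<beta> ^ s)) = 0" .
  moreover have "(\<Sum>s\<in>S - {s0}. coeff p s * \<beta> ^ (b * s) * poly f (\<beta> ^ s)) = 0"
    using fin by (intro sum.neutral) (auto simp: f_def poly_prod intro!: prod_zero)
  ultimately have "coeff p s0 * \<beta> ^ (b * s0) * poly f (\<beta> ^ s0) = 0"
    using sum.remove[OF fin s0, of "\<lambda>s. coeff p s * \<beta> ^ (b * s) * poly f (\<beta> ^ s)"] by simp
  \<comment> \<open>The support lies below \<open>n\<close>, where the powers of
    \<open>\<beta>\<close> are pairwise distinct.\<close>
  moreover have "poly f (\<beta> ^ s0) \<noteq> 0"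
  proof -
    have "\<beta> ^ s0 \<noteq> \<beta> ^ s" if "s \<in> S - {s0}" for s
      using primitive_root_of_unity_inj[OF \<beta>] that s0 Sn by (auto dest: inj_onD)
    then show ?thesis using fin by (auto simp: f_def poly_prod)
  qed
  ultimately show False
    using s0 primitive_root_of_unity_nonzero[OF \<beta>] by (simp add: S_def)
qed

text \<open>This is the distance estimate of the \<open>|u|u+v|\<close> construction: write \<open>p = A + x\<^sup>n B\<close>. Either
  \<open>A + B\<close> is a nonzero word of the code with the zeros \<open>1, \<beta>, \<dots>, \<beta>\<^sup>d\<close>, or \<open>p = (x\<^sup>n - 1) B\<close>
  and the double zeros of \<open>p\<close> are zeros of \<open>B\<close>.\<close>

lemma repeated_root_bound:
  fixes p :: "'b::field poly"
  assumes \<beta>: "primitive_root_of_unity n \<beta>" and n: "(of_nat n :: 'b) \<noteq> 0"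
    and p: "p \<noteq> 0" "degree p < 2 * n" and d: "1 \<le> d"
    and roots: "\<And>i. i \<le> d \<Longrightarrow> poly p (\<beta> ^ i) = 0"
    and double_roots: "\<And>i. 1 \<le> i \<Longrightarrow> i \<le> d \<Longrightarrow> poly (pderiv p) (\<beta> ^ i) = 0"
  shows "d + 2 \<le> card {i. coeff p i \<noteq> 0}"
proof -
  have n0: "0 < n" and \<beta>n: "\<beta> ^ n = 1" using \<beta> by (auto simp: primitive_root_of_unity_def)
  have pow: "(\<beta> ^ i) ^ n = 1" for i by (metis \<beta>n mult.commute power_mult power_one)
  define A where "A = poly_cutoff n p"
  define B where "B = poly_shift n p"
  have split: "p = (A + B) + xn1 n * B"
    using poly_cutoff_shift[of p n] by (simp add: A_def B_def algebra_simps)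
  have cA: "coeff A i = (if i < n then coeff p i else 0)" for i
    by (simp add: A_def coeff_poly_cutoff)
  have cB: "coeff B i = coeff p (i + n)" for i by (simp add: B_def coeff_poly_shift)
  have cB0: "coeff B i = 0" if "n \<le> i" for i
    using that p(2) by (simp add: cB coeff_eq_0)
  let ?sA = "{i. coeff A i \<noteq> 0}" and ?sB = "{i. coeff B i \<noteq> 0}"
  have "{i. coeff p i \<noteq> 0} = ?sA \<union> (\<lambda>i. i + n) ` ?sB"
  proof (intro equalityI subsetI)
    fix i assume i: "i \<in> {i. coeff p i \<noteq> 0}"
    show "i \<in> ?sA \<union> (\<lambda>i. i + n) ` ?sB"
    proof (cases "i < n")
      case False
      then have "i - n \<in> ?sB" "i = (i - n) + n" using i by (simp_all add: cB)
      then show ?thesis by blast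
    qed (use i in \<open>simp add: cA\<close>)
  qed (auto simp: cA cB split: if_splits)
  moreover have "?sA \<inter> (\<lambda>i. i + n) ` ?sB = {}" by (auto simp: cA)
  ultimately have card: "card {i. coeff p i \<noteq> 0} = card ?sA + card ?sB"
    by (simp add: card_Un_disjoint finite_poly_support card_image)
  show ?thesis
  proof (cases "A + B = 0")
    case False
    have deg: "degree (A + B) < n"
    proof -
      have "degree (A + B) \<le> n - 1" by (rule degree_le) (auto simp: cA cB0)
      then show ?thesis using n0 by simp
    qed
    \<comment> \<open>The exponents start at 0, which gives \<open>d + 1\<close> consecutive zeros
      and so weight at least \<open>d + 2\<close>.\<close>
    have "poly (A + B) (\<beta> ^ (0 + i)) = 0" if "i < d + 1" for i
      using roots[of i] that arg_cong[OF split, of "\<lambda>r. poly r (\<beta> ^ i)"]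
      by (simp add: poly_monom pow)
    from bch_bound[OF \<beta> False deg this] have "d + 1 < card {i. coeff (A + B) i \<noteq> 0}" .
    also have "\<dots> \<le> card (?sA \<union> ?sB)"
      by (intro card_mono) (auto simp: finite_poly_support)
    also have "\<dots> \<le> card ?sA + card ?sB" by (rule card_Un_le)
    finally show ?thesis using card by simp
  next
    case True
    then have pB: "p = xn1 n * B" using split by simp
    then have B: "B \<noteq> 0" using p by auto
    have "degree B \<le> n - 1" using cB0 n0 by (intro degree_le) auto
    then have degB: "degree B < n" using n0 by simp
    have "poly B (\<beta> ^ (1 + i)) = 0" if "i < d" for i
    proof -
      define r where "r = \<beta> ^ (1 + i)"
      have r: "r ^ n = 1" "r \<noteq> 0"
        unfolding r_def using pow[of "1 + i"] primitive_root_of_unity_nonzero[OF \<beta>] by simp_all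
      \<comment> \<open>At a zero of \<open>xn1 n\<close> only the term with the derivative of
        \<open>xn1 n\<close> survives, and its factor in front of \<open>B\<close> is
        nonzero.\<close>
      have "poly (pderiv p) r = of_nat n * r ^ (n - 1) * poly B r"
        by (simp add: pB pderiv_mult pderiv_diff pderiv_monom poly_monom r)
      moreover have "poly (pderiv p) r = 0"
        unfolding r_def using double_roots[of "1 + i"] that by simp
      ultimately have "poly B r = 0" using n r by simp
      then show ?thesis by (simp only: r_def)
    qed
    from bch_bound[OF \<beta> B degB this] have "d < card ?sB" .
    \<comment> \<open>Here \<open>A = - B\<close>, so each half has weight at least
      \<open>d + 1\<close>.\<close>
    moreover have "?sA = ?sB" using True
      by (metis (no_types, lifting) add.inverse_inverse add_eq_0_iff coeff_minus neg_equal_0_iff_equal)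
    ultimately show ?thesis using card d by simp
  qed
qed

subsection \<open>Minimal polynomials over finite fields\<close>

text \<open>Multiplication by a nonzero \<open>x\<close> permutes the nonzero elements, so their
  product can be cancelled from both sides.\<close>

lemma finite_field_power_card: "(x :: 'a::{field,finite}) ^ CARD('a) = x"
proof (cases "x = 0")
  case False
  let ?P = "\<Prod>y\<in>UNIV - {0 :: 'a}. y"
  have "?P = (\<Prod>y\<in>UNIV - {0}. x * y)"
    by (rule prod.reindex_bij_witness[of _ "\<lambda>y. x * y" "\<lambda>y. y / x"]) (use False in auto)
  also have "\<dots> = x ^ card (UNIV - {0 :: 'a}) * ?P" by (simp add: prod.distrib)
  finally have "x ^ card (UNIV - {0 :: 'a}) = 1" by simp
  moreover have "CARD('a) = Suc (card (UNIV - {0 :: 'a}))"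
    using card.remove[of UNIV "0 :: 'a"] by simp
  ultimately show ?thesis by (simp only: power_Suc mult_1_right)
qed (simp add: power_0_left)

text \<open>An even power of \<open>-1\<close> is 1, but raising to the field size fixes
  \<open>-1\<close>.\<close>

lemma finite_field_char_2:
  assumes "even CARD('a::{field,finite})"
  shows "CHAR('a) = 2"
proof -
  have "(- 1 :: 'a) = 1" using finite_field_power_card[of "- 1 :: 'a"] assms by simp
  then have "(1 :: 'a) + 1 = 0" using add.right_inverse[of "1 :: 'a"] by simp
  then have "(of_nat 2 :: 'a) = 0" by simp
  then have "CHAR('a) dvd 2" by (simp only: of_nat_eq_0_iff_char_dvd)
  then have "CHAR('a) \<le> 2" "CHAR('a) \<noteq> 0" by (auto dest: dvd_imp_le intro!: Nat.gr0I)
  moreover have "CHAR('a) \<noteq> 1" by (metis of_nat_CHAR of_nat_1 zero_neq_one)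
  ultimately show ?thesis by linarith
qed

text \<open>The polynomial \<open>x^q - x\<close> has at most \<open>q\<close> roots, and the
  \<open>q\<close> elements of the image are already roots.\<close>

lemma field_hom_range_eq:
  fixes \<phi> :: "'a::{field,finite} \<Rightarrow> 'b::field"
  assumes "field_hom \<phi>" "y ^ CARD('a) = y"
  shows "y \<in> range \<phi>"
proof -
  interpret field_hom \<phi> by fact
  let ?q = "CARD('a)"
  let ?f = "monom 1 ?q - monom 1 1 :: 'b poly"
  have "card {0, 1 :: 'a} \<le> ?q" by (rule card_mono) auto
  then have q: "2 \<le> ?q" by simp
  have dq: "degree ?f = ?q"
    using q by (intro antisym degree_le le_degree) (auto simp: coeff_diff)
  then have nz: "?f \<noteq> 0" using q by (metis degree_0 not_numeral_le_zero)
  have "range \<phi> = {x. poly ?f x = 0}"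
  proof (rule card_seteq)
    show "finite {x. poly ?f x = 0}" using nz by (rule poly_roots_finite)
    show "range \<phi> \<subseteq> {x. poly ?f x = 0}"
      by (auto simp: poly_monom hom_power[symmetric] finite_field_power_card)
    have "card {x. poly ?f x = 0} \<le> ?q" using poly_roots_degree[OF nz] dq by simp
    also have "?q = card (range \<phi>)" by (rule card_image[symmetric]) (rule inj_f)
    finally show "card {x. poly ?f x = 0} \<le> card (range \<phi>)" .
  qed
  then show ?thesis using assms(2) by (simp add: poly_monom)
qed

lemma is_minimal_poly_dvd:
  fixes \<phi> :: "'a::field \<Rightarrow> 'b::field"
  assumes \<phi>: "field_hom \<phi>" and p: "is_minimal_poly \<phi> x p" and r: "poly (map_poly \<phi> r) x = 0"
  shows "p dvd r"
proof -
  interpret field_hom \<phi> by fact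
  interpret map_poly_hom: map_poly_comm_ring_hom \<phi> ..
  have p0: "p \<noteq> 0" using p by (auto simp: is_minimal_poly_def)
  have "map_poly \<phi> r = map_poly \<phi> (p * (r div p)) + map_poly \<phi> (r mod p)"
    by (simp only: map_poly_hom.hom_add[symmetric] mult_div_mod_eq)
  then have "poly (map_poly \<phi> (r mod p)) x = 0"
    using p r by (simp add: map_poly_hom.hom_mult is_minimal_poly_def)
  then have "r mod p = 0"
    using p degree_mod_less[OF p0, of r] by (fastforce simp: is_minimal_poly_def)
  then show ?thesis by auto
qed

text \<open>The definite description needs existence and uniqueness: a nonzero annihilator of least
  degree can be made monic, and two minimal polynomials divide each other.\<close>

lemma is_minimal_poly_minimal_poly:
  fixes \<phi> :: "'a::field \<Rightarrow> 'b::field"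
  assumes \<phi>: "field_hom \<phi>" and r: "r \<noteq> 0" "poly (map_poly \<phi> r) x = 0"
  shows "is_minimal_poly \<phi> x (minimal_poly \<phi> x)"
proof -
  interpret field_hom \<phi> by fact
  let ?P = "\<lambda>p. p \<noteq> 0 \<and> poly (map_poly \<phi> p) x = 0"
  obtain p where p: "?P p" and least: "\<And>s. ?P s \<Longrightarrow> degree p \<le> degree s"
    using ex_has_least_nat[of ?P r degree] r by blast
  let ?p = "Polynomial.smult (inverse (lead_coeff p)) p"
  have "is_minimal_poly \<phi> x ?p"
    using p least by (auto simp: is_minimal_poly_def map_poly_hom_smult)
  moreover have "a = b" if "is_minimal_poly \<phi> x a" "is_minimal_poly \<phi> x b" for a b
    using that is_minimal_poly_dvd[OF \<phi> that(1), of b] is_minimal_poly_dvd[OF \<phi> that(2), of a]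
    by (intro poly_dvd_antisym) (auto simp: is_minimal_poly_def)
  ultimately have "\<exists>!p. is_minimal_poly \<phi> x p" by blast
  then show ?thesis unfolding minimal_poly_def by (rule theI')
qed

text \<open>The product below is fixed by the Frobenius map on the coefficients, so they lie in the image
  of the ground field.\<close>

lemma ex_conjugates_poly:
  fixes \<phi> :: "'a::{field,finite} \<Rightarrow> 'b::field"
  assumes \<phi>: "field_hom \<phi>" and char: "prime CHAR('b)" and q: "CARD('a) = CHAR('b) ^ s"
    and x: "x ^ (CARD('a) ^ m) = x"
  obtains P where "map_poly \<phi> P = (\<Prod>l<m. [:- (x ^ (CARD('a) ^ l)), 1:])"
proof -
  interpret field_hom \<phi> by fact
  let ?q = "CARD('a)"
  let ?frob = "\<lambda>y :: 'b. y ^ ?q"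
  interpret frob: comm_ring_hom ?frob
    by unfold_locales (simp_all add: freshmans_dream'[OF char q] power_mult_distrib power_0_left)
  interpret frob_poly: map_poly_comm_ring_hom ?frob ..
  let ?g = "\<lambda>l. [:- (x ^ (?q ^ l)), 1:]"
  let ?M = "\<Prod>l<m. ?g l"
  have "map_poly ?frob ?M = (\<Prod>l<m. ?g (Suc l))"
    unfolding frob_poly.hom_prod
    by (intro prod.cong refl)
      (simp add: frob.map_poly_pCons_hom frob.hom_uminus power_mult[symmetric] mult.commute)
  \<comment> \<open>Frobenius shifts the index of the factors by one, and the new last factor equals
    the old first one because \<open>x ^ (q ^ m) = x\<close>. The extra factor \<open>?g 0\<close>
    on both sides makes the products match and is cancelled later.\<close>
  also have "?g 0 * \<dots> = ?g 0 * ?M"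
  proof -
    have "?g 0 * (\<Prod>l<m. ?g (Suc l)) = ?M * ?g m" 
      using prod.lessThan_Suc_shift[of ?g m] by (simp only: prod.lessThan_Suc)
    also have "?g m = ?g 0" using x by simp
    finally show ?thesis by (simp only: mult.commute)
  qed
  finally have "?g 0 * map_poly ?frob ?M = ?g 0 * ?M" .
  moreover have "?g 0 \<noteq> 0" by simp
  ultimately have fixed: "map_poly ?frob ?M = ?M" by (rule mult_left_cancel[THEN iffD1, rotated])
  have coeffs: "coeff ?M i \<in> range \<phi>" for i
  proof (rule field_hom_range_eq[OF \<phi>])
    show "coeff ?M i ^ ?q = coeff ?M i" by (metis fixed frob.coeff_map_poly_hom)
  qed
  \<comment> \<open>Coefficients commute with \<open>map_poly\<close> only for a function that fixes
    zero.\<close>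
  have "inv_into UNIV \<phi> 0 = 0" by (metis hom_zero inj_f inv_f_f)
  then have "map_poly \<phi> (map_poly (inv_into UNIV \<phi>) ?M) = ?M"
    using coeffs by (intro poly_eqI) (simp add: coeff_map_poly f_inv_into_f)
  then show ?thesis by (rule that)
qed

text \<open>The polynomial with roots \<open>x ^ (q ^ l)\<close>, \<open>l < m\<close>, has
  coefficients in the ground field and is a multiple of the minimal polynomial of \<open>x\<close>.
  The least common multiple therefore divides the product of these polynomials over
  \<open>X\<close>.\<close>

lemma root_of_Lcm_minimal_poly:
  fixes \<phi> :: "'a::{field_gcd,finite} \<Rightarrow> 'b::field"
  assumes \<phi>: "field_hom \<phi>" and char: "prime CHAR('b)" and q: "CARD('a) = CHAR('b) ^ s"
    and m: "0 < m" and X: "finite X" "\<And>x. x \<in> X \<Longrightarrow> x ^ (CARD('a) ^ m) = x"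
    and root: "poly (map_poly \<phi> (Lcm (minimal_poly \<phi> ` X))) y = 0"
  obtains x l where "x \<in> X" "l < m" "y = x ^ (CARD('a) ^ l)"
proof -
  interpret field_hom \<phi> by fact
  interpret map_poly_hom: map_poly_comm_ring_hom \<phi> ..
  let ?M = "\<lambda>x :: 'b. \<Prod>l<m. [:- (x ^ (CARD('a) ^ l)), 1:]"
  have "\<forall>x\<in>X. \<exists>P. map_poly \<phi> P = ?M x"
    using ex_conjugates_poly[OF \<phi> char q X(2)] by metis
  then obtain P where P: "\<And>x. x \<in> X \<Longrightarrow> map_poly \<phi> (P x) = ?M x" by metis
  have M0: "?M x \<noteq> 0" for x by (subst prod_zero_iff) auto
  have "minimal_poly \<phi> x dvd (\<Prod>x\<in>X. P x)" if x: "x \<in> X" for x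
  proof -
    have "poly (?M x) x = 0" using m by (auto simp: poly_prod intro!: bexI[of _ 0])
    then have rt: "poly (map_poly \<phi> (P x)) x = 0" by (simp only: P[OF x])
    have "P x \<noteq> 0" using P[OF x] M0[of x] by auto
    then have "minimal_poly \<phi> x dvd P x"
      using is_minimal_poly_dvd[OF \<phi> is_minimal_poly_minimal_poly[OF \<phi> _ rt] rt] by blast
    also have "P x dvd (\<Prod>x\<in>X. P x)" using X(1) x by (rule dvd_prodI)
    finally show ?thesis .
  qed
  then have "Lcm (minimal_poly \<phi> ` X) dvd (\<Prod>x\<in>X. P x)" by (intro Lcm_least) auto
  then have "map_poly \<phi> (Lcm (minimal_poly \<phi> ` X)) dvd (\<Prod>x\<in>X. ?M x)"
    using map_poly_hom.hom_dvd[of _ "\<Prod>x\<in>X. P x"] by (simp add: map_poly_hom.hom_prod P)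
  then have "poly (\<Prod>x\<in>X. ?M x) y = 0" using root by (auto elim!: dvdE)
  then show ?thesis using that X(1) by (auto simp: poly_prod)
qed

text \<open>All the minimal polynomials divide \<open>xn1 n\<close>, hence so does \<open>G\<close>;
  it is then nonzero, and being normalized it is monic.\<close>

lemma Lcm_minimal_poly:
  fixes \<phi> :: "'a::field_gcd \<Rightarrow> 'b::field"
  assumes \<phi>: "field_hom \<phi>" and n: "0 < n" and X: "\<And>x. x \<in> X \<Longrightarrow> x ^ n = 1"
  defines "G \<equiv> Lcm (minimal_poly \<phi> ` X)"
  shows "G dvd xn1 n" "monic G" "\<And>x. x \<in> X \<Longrightarrow> poly (map_poly \<phi> G) x = 0"
proof -
  interpret field_hom \<phi> by fact
  interpret map_poly_hom: map_poly_comm_ring_hom \<phi> ..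
  have xn: "map_poly \<phi> (xn1 n) = xn1 n" by (simp add: map_poly_hom.hom_minus)
  have rt: "poly (map_poly \<phi> (xn1 n)) x = 0" if "x \<in> X" for x
    using X[OF that] by (simp add: xn poly_monom)
  have min: "is_minimal_poly \<phi> x (minimal_poly \<phi> x)" if "x \<in> X" for x
    using is_minimal_poly_minimal_poly[OF \<phi> xn1_nonzero[OF n] rt[OF that]] .
  show dvd: "G dvd xn1 n"
    unfolding G_def using is_minimal_poly_dvd[OF \<phi> min rt] by (intro Lcm_least) auto
  have "G \<noteq> 0" using dvd xn1_nonzero[OF n, where 'a='a] by auto
  moreover have "normalize G = G" unfolding G_def by (rule normalize_Lcm)
  moreover have "coeff (normalize G) (degree G) = 1" using \<open>G \<noteq> 0\<close> by simp
  ultimately show "monic G" by (simp only:)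
  show "poly (map_poly \<phi> G) x = 0" if x: "x \<in> X" for x
  proof -
    have "minimal_poly \<phi> x dvd G" unfolding G_def using x by (intro dvd_Lcm) auto
    then have "map_poly \<phi> (minimal_poly \<phi> x) dvd map_poly \<phi> G" by (rule map_poly_hom.hom_dvd)
    then show ?thesis using min[OF x] by (auto simp: is_minimal_poly_def elim!: dvdE)
  qed
qed

subsection \<open>Cyclotomic cosets\<close>

text \<open>Write \<open>m = 2 * k + 1\<close>. For \<open>l \<le> k\<close> the sum lies strictly
  between 0 and \<open>q ^ m - 1\<close>. For larger \<open>l\<close>, multiplying by
  \<open>q ^ (m - l)\<close> and using \<open>q ^ m = 1\<close> modulo \<open>q ^ m - 1\<close>
  exchanges the roles of \<open>i\<close> and \<open>j\<close> and replaces \<open>l\<close> by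
  \<open>m - l \<le> k\<close>.\<close>

lemma not_dvd_add_mult_power:
  fixes q m i j l :: nat
  assumes q: "2 \<le> q" and m: "odd m" and l: "l < m"
    and j: "1 \<le> j" "j \<le> q ^ ((m + 1) div 2) - q" and i: "i \<le> q ^ ((m + 1) div 2) - q"
  shows "\<not> q ^ m - 1 dvd i + j * q ^ l"
proof -
  obtain k where k: "m = 2 * k + 1" using m by (elim oddE)
  let ?d = "q ^ (k + 1) - q"
  have half: "(m + 1) div 2 = k + 1" by (simp add: k)
  \<comment> \<open>The largest value is \<open>?d + ?d * q ^ k\<close>. With this \<open>?d\<close>
    the terms \<open>q ^ (k + 1)\<close> cancel and leave \<open>q ^ m - q\<close>, just below the
    bound.\<close>
  have small: "a + b * q ^ e < q ^ m - 1" if "a \<le> ?d" "b \<le> ?d" "e \<le> k" for a b e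
  proof -
    have "b * q ^ e \<le> ?d * q ^ k"
      using that q by (intro mult_le_mono power_increasing) auto
    then have "a + b * q ^ e \<le> ?d + ?d * q ^ k" using that by linarith
    also have "?d * q ^ k = q ^ m - q ^ (k + 1)"
      by (simp add: k diff_mult_distrib power_add mult_2)
    also have "?d + (q ^ m - q ^ (k + 1)) = q ^ m - q"
    proof -
      have "q ^ 1 \<le> q ^ (k + 1)" "q ^ (k + 1) \<le> q ^ m"
        using q by (intro power_increasing; simp add: k)+
      then show ?thesis by simp
    qed
    also have "\<dots> < q ^ m - 1"
    proof -
      have "q ^ 1 \<le> q ^ m" using q by (intro power_increasing) (auto simp: k)
      then show ?thesis using q by simp
    qed
    finally show ?thesis .
  qed
  show ?thesis
  proof (cases "l \<le> k")
    case True
    then have "i + j * q ^ l < q ^ m - 1" using small[of i j l] True i j by (simp only: half)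
    moreover have "0 < i + j * q ^ l" using j q by simp
    ultimately show ?thesis by (rule nat_dvd_not_less[rotated])
  next
    case False
    show ?thesis
    proof
      assume "q ^ m - 1 dvd i + j * q ^ l"
      then have "q ^ m - 1 dvd (i + j * q ^ l) * q ^ (m - l)" by (rule dvd_mult2)
      also have "(i + j * q ^ l) * q ^ (m - l) = (j + i * q ^ (m - l)) + (q ^ m - 1) * j"
      proof -
        have "q ^ l * q ^ (m - l) = (q ^ m - 1) + 1" using l q by (simp flip: power_add)
        moreover have "(i + j * q ^ l) * q ^ (m - l) = i * q ^ (m - l) + j * (q ^ l * q ^ (m - l))"
          by (simp only: distrib_right mult.assoc)
        ultimately show ?thesis by (simp only: distrib_left mult_1_right ac_simps)
      qed
      finally have "q ^ m - 1 dvd j + i * q ^ (m - l)" by (simp add: dvd_add_left_iff)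
      moreover have "j + i * q ^ (m - l) < q ^ m - 1"
        using small[of j i "m - l"] False i j by (simp add: half k)
      ultimately show False using j by (auto dest: nat_dvd_not_less[rotated])
    qed
  qed
qed

subsection \<open>Self-dual repeated-root codes\<close>

lemma self_dual_repeated_root_code:
  fixes g h :: "'a::field poly"
  assumes char: "CHAR('a) = 2" and n: "0 < n" and g: "monic g" and gh: "g * h = xn1 n"
  defines "gp \<equiv> monic_reciprocal h"
  shows "g * gp dvd xn1 (2 * n)" "monic (g * gp)" "degree (g * gp) = n"
    and "euclidean_self_dual (2 * n) (cyclic_code (2 * n) (g * gp))"
proof -
  have dvd: "g dvd xn1 n" "h dvd xn1 n" by (simp_all flip: gh)
  have g0: "poly g 0 \<noteq> 0" and h0: "poly h 0 \<noteq> 0"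
    using dvd poly_0_neq_0_if_dvd_xn1 n by blast+
  \<comment> \<open>Since \<open>xn1 n\<close> is its own monic reciprocal, the reciprocals of
    complementary factors are again complementary.\<close>
  have mr: "monic_reciprocal g * gp = xn1 n"
    using monic_reciprocal_mult[of g h] monic_reciprocal_xn1[OF n, where 'a='a]
    by (simp add: gp_def gh)
  have "of_nat 2 = (0 :: 'a)" using char by (metis of_nat_CHAR)
  then have two: "(1 :: 'a) + 1 = 0" by simp
  \<comment> \<open>The polynomials \<open>(a - 1)^2\<close> and \<open>a^2 - 1\<close> differ by
    \<open>2 (a - 1)\<close>, which vanishes in characteristic 2.\<close>
  have sq: "(xn1 (2 * n) :: 'a poly) = xn1 n * xn1 n"
  proof -
    have "(a - 1) * (a - 1) = (a * a - 1) - (1 + 1) * (a - 1)" for a :: "'a poly"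
      by (simp only: left_diff_distrib right_diff_distrib distrib_right mult_1_left mult_1_right) simp
    from this[of "monom 1 n"] show ?thesis
      using two by (simp only: mult_monom mult_1 mult_2 one_pCons add_pCons add_0 pCons_0_0
        mult_zero_left diff_zero)
  qed
  define h' where "h' = h * monic_reciprocal g"
  have "(g * gp) * h' = (g * h) * (monic_reciprocal g * gp)"
    by (simp only: h'_def ac_simps)
  then have eq: "(g * gp) * h' = xn1 (2 * n)" by (simp only: gh mr sq)
  then show "g * gp dvd xn1 (2 * n)" by (metis dvd_triv_left)
  have mgp: "monic gp" unfolding gp_def by (rule monic_monic_reciprocal[OF h0])
  with g show "monic (g * gp)" by (rule monic_mult)
  have nz: "g \<noteq> 0" "h \<noteq> 0" "gp \<noteq> 0" using g h0 mgp by auto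
  \<comment> \<open>Because \<open>h\<close> has a nonzero constant term, \<open>gp\<close> has the
    degree of \<open>h\<close>.\<close>
  show "degree (g * gp) = n"
    using nz degree_monic_reciprocal[OF h0] arg_cong[OF gh, of degree]
    by (simp add: degree_mult_eq degree_xn1 gp_def)
  have "monic_reciprocal h' = g * gp"
    using monic_reciprocal_monic_reciprocal[OF g g0]
    by (simp add: h'_def monic_reciprocal_mult gp_def mult.commute)
  then show "euclidean_self_dual (2 * n) (cyclic_code (2 * n) (g * gp))"
    using euclidean_dual_cyclic_code[OF eq] n by (simp add: euclidean_self_dual_def)
qed

text \<open>Starting at exponent 1, all exponents are positive, so integer powers can be replaced by
  natural ones.\<close>

lemma bch_code_eq:
  "bch_code \<phi> n \<delta> 1 \<beta>
    = cyclic_code n (Lcm (minimal_poly \<phi> ` (\<lambda>i. \<beta> ^ i) ` {1..nat (\<delta> - 1)}))"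
proof -
  have "{1..1 + \<delta> - 2} = int ` {1..nat (\<delta> - 1)}"
  proof (intro equalityI subsetI)
    fix i assume "i \<in> {1..1 + \<delta> - 2}"
    then have "i = int (nat i)" "nat i \<in> {1..nat (\<delta> - 1)}" by auto
    then show "i \<in> int ` {1..nat (\<delta> - 1)}" by blast
  qed auto
  then show ?thesis by (simp only: bch_code_def image_image power_int_of_nat)
qed

theorem theorem9:
  fixes \<phi> :: "'a::{field_gcd,finite} \<Rightarrow> 'b::{field,finite}"
    and q m n :: nat and \<delta> :: int and \<beta> :: 'b
    and g h gp :: "'a poly" and C C' :: "'a vec set"
  assumes "\<exists>s>0. q = 2 ^ s"
    and "odd m"
    and "CARD('a) = q"
    and "CARD('b) = q ^ m"
    and "field_hom \<phi>"
    and "n = q ^ m - 1"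
    and "primitive_root_of_unity n \<beta>"
    and "\<delta> = int q ^ ((m + 1) div 2) - int q + 1"
    and "\<delta> \<ge> 2"
    and "C = bch_code \<phi> n \<delta> 1 \<beta>"
    and "g = generator_poly n C"
    and "h = (monom 1 n - 1) div g"
    and "gp = monic_reciprocal h"
    and "C' = cyclic_code (2 * n) (g * gp)"
  shows "is_generator_poly n (euclidean_dual n C) gp \<and>
    is_generator_poly (2 * n) C' (g * gp) \<and>
    is_cyclic_code (2 * n) C' \<and>
    euclidean_self_dual (2 * n) C' \<and>
    (\<exists>d. is_code (2 * (q ^ m - 1)) (q ^ m - 1) d C' \<and>
         int d \<ge> int q ^ ((m + 1) div 2) - int q + 2)"
proof -
  note \<phi> = assms(5) and \<beta> = assms(7)
  interpret field_hom \<phi> by fact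
  interpret map_poly_hom: map_poly_comm_ring_hom \<phi> ..
  obtain s where s: "0 < s" "q = 2 ^ s" using assms(1) by blast
  have m: "0 < m" using assms(2) by (rule odd_pos)
  have charA: "CHAR('a) = 2" and charB: "CHAR('b) = 2"
    using s m by (simp_all add: finite_field_char_2 assms(3,4))
  have q2: "2 \<le> q" using s by (cases s) auto
  have n: "0 < n" and \<beta>n: "\<beta> ^ n = 1" and \<beta>0: "\<beta> \<noteq> 0"
    using \<beta> primitive_root_of_unity_nonzero by (auto simp: primitive_root_of_unity_def)
  have "(of_nat n :: 'b) \<noteq> 0"
  proof -
    have "odd n" using s m by (simp add: assms(6))
    then show ?thesis by (simp add: of_nat_eq_0_iff_char_dvd charB)
  qed
  define d where "d = q ^ ((m + 1) div 2) - q"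
  \<comment> \<open>This makes the truncated subtraction in \<open>d\<close> agree with the integer
    subtraction in \<open>\<delta>\<close>.\<close>
  have "q ^ 1 \<le> q ^ ((m + 1) div 2)" using q2 m assms(2) by (intro power_increasing) (auto elim: oddE)
  then have \<delta>: "\<delta> = int d + 1" by (simp add: d_def assms(8) of_nat_diff)
  have d: "1 \<le> d" using \<delta> assms(9) by simp
  define X where "X = (\<lambda>i. \<beta> ^ i) ` {1..d}"
  have Xn: "x ^ n = 1" if "x \<in> X" for x
    using that \<beta>n by (auto simp: X_def) (metis mult.commute power_mult power_one)
  have qm: "q ^ m = Suc n" using q2 by (simp add: assms(6))
  define G where "G = Lcm (minimal_poly \<phi> ` X)"
  note G = Lcm_minimal_poly[OF \<phi> n Xn, of X, folded G_def]
  have C: "C = cyclic_code n G" by (simp add: assms(10) bch_code_eq \<delta> G_def X_def)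
  have gG: "g = G" using generator_poly_cyclic_code[OF G(2,1) n] by (simp add: assms(11) C)
  have gh: "g * h = xn1 n" using G(1) by (simp add: assms(12) gG)
  note sd = self_dual_repeated_root_code[OF charA n G(2)[folded gG] gh, folded assms(13)]
  have h0: "poly h 0 \<noteq> 0"
    by (rule poly_0_neq_0_if_dvd_xn1[OF _ n]) (simp flip: gh)
  have gp_dvd: "gp dvd xn1 n"
    using monic_reciprocal_mult[of g h] monic_reciprocal_xn1[OF n, where 'a='a]
    by (metis assms(13) dvd_triv_right gh)

  \<comment> \<open>Zeros of \<open>g\<close> and \<open>gp\<close> in the extension field\<close>
  have g_root: "poly (map_poly \<phi> g) (\<beta> ^ i) = 0" if "1 \<le> i" "i \<le> d" for i
    using G(3)[of "\<beta> ^ i"] that by (simp add: gG X_def)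
  \<comment> \<open>Such a zero would be a conjugate of some \<open>\<beta> ^ j\<close> with
    \<open>1 \<le> j \<le> d\<close>, giving \<open>\<beta> ^ (i + j * q ^ l) = 1\<close>. The case
    \<open>i = 0\<close> says that 1 is not a zero of \<open>g\<close>.\<close>
  have g_nonroot: "poly (map_poly \<phi> g) (inverse (\<beta> ^ i)) \<noteq> 0" if i: "i \<le> d" for i
  proof
    assume "poly (map_poly \<phi> g) (inverse (\<beta> ^ i)) = 0"
    moreover have "prime CHAR('b)" "CARD('a) = CHAR('b) ^ s" using s by (simp_all add: charB assms(3))
    moreover have "x ^ (CARD('a) ^ m) = x" if "x \<in> X" for x
      using Xn[OF that] by (simp add: assms(3) qm)
    ultimately obtain x l where x: "x \<in> X" "l < m" "inverse (\<beta> ^ i) = x ^ (CARD('a) ^ l)"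
      using root_of_Lcm_minimal_poly[OF \<phi> _ _ m, of s X] unfolding gG G_def X_def by blast
    then obtain j where j: "1 \<le> j" "j \<le> d" "x = \<beta> ^ j" by (auto simp: X_def)
    have "\<beta> ^ (i + j * q ^ l) = \<beta> ^ i * inverse (\<beta> ^ i)"
      by (simp add: x(3) j(3) assms(3) power_add power_mult)
    then have "n dvd i + j * q ^ l"
      using \<beta>0 by (intro primitive_root_of_unity_dvd[OF \<beta>]) simp
    then show False
      using not_dvd_add_mult_power[OF q2 assms(2) x(2), of j i] i j by (simp add: d_def assms(6))
  qed
  \<comment> \<open>At the inverse of \<open>\<beta> ^ i\<close> the product \<open>g * h\<close>
    vanishes but \<open>g\<close> does not, so \<open>h\<close> does; taking the reciprocal inverts
    the zero.\<close>
  have gp_root: "poly (map_poly \<phi> gp) (\<beta> ^ i) = 0" if "i \<le> d" for i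
  proof -
    have "map_poly \<phi> g * map_poly \<phi> h = xn1 n"
      using arg_cong[OF gh, of "map_poly \<phi>"] by (simp add: map_poly_hom.hom_mult map_poly_hom.hom_minus)
    then have "poly (map_poly \<phi> g * map_poly \<phi> h) (inverse (\<beta> ^ i)) = 0"
      using \<beta>n by (simp add: poly_monom power_inverse flip: power_mult)
        (metis mult.commute power_mult power_one)
    then have "poly (map_poly \<phi> h) (inverse (\<beta> ^ i)) = 0" using g_nonroot[OF that] by simp
    \<comment> \<open>The embedding preserves degrees and inverses, so it commutes with forming the
      monic reciprocal.\<close>
    moreover have "map_poly \<phi> gp = monic_reciprocal (map_poly \<phi> h)"
      unfolding assms(13) monic_reciprocal_def
      by (intro poly_eqI) (simp add: coeff_reflect_poly hom_inverse poly_0_coeff_0 hom_mult)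
    moreover have "poly (map_poly \<phi> h) 0 \<noteq> 0" using h0 by (simp add: poly_0_coeff_0)
    ultimately show ?thesis using \<beta>0 by (simp add: poly_monic_reciprocal_eq_0_iff)
  qed

  have wt: "d + 2 \<le> card {i. coeff p i \<noteq> 0}"
    if p: "p \<noteq> 0" "degree p < 2 * n" "g * gp dvd p" for p
  proof -
    let ?p = "map_poly \<phi> p"
    obtain u where "p = g * gp * u" using p(3) by (rule dvdE)
    then have u: "?p = map_poly \<phi> g * map_poly \<phi> gp * map_poly \<phi> u"
      by (simp add: map_poly_hom.hom_mult)
    have "d + 2 \<le> card {i. coeff ?p i \<noteq> 0}"
    proof (rule repeated_root_bound[OF \<beta> \<open>of_nat n \<noteq> 0\<close> _ _ d])
      show "?p \<noteq> 0" "degree ?p < 2 * n" using p by simp_all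
      show "poly ?p (\<beta> ^ i) = 0" if "i \<le> d" for i by (simp add: u gp_root[OF that])
      \<comment> \<open>Every summand of the derivative of the product still contains
        \<open>g\<close> or \<open>gp\<close>, and both vanish here.\<close>
      show "poly (pderiv ?p) (\<beta> ^ i) = 0" if "1 \<le> i" "i \<le> d" for i
        by (simp add: u pderiv_mult gp_root[OF that(2)] g_root[OF that])
    qed
    \<comment> \<open>An injective embedding keeps the support, so the weight bound descends to the
      ground field.\<close>
    also have "{i. coeff ?p i \<noteq> 0} = {i. coeff p i \<noteq> 0}" by simp
    finally show ?thesis .
  qed
  have "d + 2 \<le> min_distance C'"
    unfolding assms(14) using sd(1,3) n wt by (intro min_distance_cyclic_code_ge) auto
  moreover have "is_code (2 * n) n (min_distance C') C'"
    using subspace_dim_cyclic_code[OF sd(1)] n sd(3) by (simp add: is_code_def assms(14))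
  ultimately have "\<exists>d. is_code (2 * (q ^ m - 1)) (q ^ m - 1) d C' \<and>
         int d \<ge> int q ^ ((m + 1) div 2) - int q + 2"
    using \<delta> assms(8) by (intro exI[of _ "min_distance C'"]) (simp add: assms(6))
  moreover have "is_generator_poly n (euclidean_dual n C) gp"
    using euclidean_dual_cyclic_code[OF gh n] monic_monic_reciprocal[OF h0] gp_dvd
    by (simp add: is_generator_poly_def C gG assms(13))
  moreover have "is_generator_poly (2 * n) C' (g * gp)"
    using sd(1,2) by (simp add: is_generator_poly_def assms(14))
  moreover have "is_cyclic_code (2 * n) C'"
    unfolding assms(14) using sd(1) n by (intro is_cyclic_code_cyclic_code) simp_all
  ultimately show ?thesis using sd(4) by (simp add: assms(14))
qed

end
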